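(* Fix $\beta>1$. Let $(r_k)_{k\ge 1}$ be a sequence of positive real numbers such that $r_k \asymp k^{-1}(\log k)^{-\beta}$ for all $k\ge 2$, i.e., there are constants $0<c\le C<\infty$, not depending on $k$, such that $c\,k^{-1}(\log k)^{-\beta}\le r_k\le C\,k^{-1}(\log k)^{-\beta}$ for all $k\ge 2$. Consider the birth-and-death Markov chain $\{S_n\}_{n\ge 0}$ on $\{1,2,3,\ldots\}$ whose transition probability from $1$ to $2$ is $1$ and, for every $k\ge 2$, whose transition probability from $k$ to $k+1$ is $r_{k-1}/(r_{k-1}+r_k)$ and from $k$ to $k-1$ is $r_k/(r_{k-1}+r_k)$. Then this chain is transient and almost surely has only finitely many cutpoints.
   Context: A Markov chain $\{S_n\}_{n\ge 0}$ on a countable state space is transient if almost surely it visits each state only finitely often. A state $x$ is a cutpoint of the trajectory $(S_0,S_1,\ldots)$ if for some $k\ge 0$ we have $S_k=x$ and the sets $\{S_{k+1},S_{k+2},\ldots\}$ and $\{S_0,S_1,\ldots,S_k\}$ are disjoint. No particular initial state is prescribed: the chain may be started from any state. *)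

theory Defs
  imports "HOL-Probability.Probability"
begin

text \<open>
  The law of \<open>S 0\<close> is left unconstrained. As \<open>cond_prob\<close> divides by the probability of the
  condition, the transition law is only required for histories of positive probability.
\<close>

definition markov_chain ::
    "'s set \<Rightarrow> ('s \<Rightarrow> 's \<Rightarrow> real) \<Rightarrow> 'a measure \<Rightarrow> (nat \<Rightarrow> 'a \<Rightarrow> 's) \<Rightarrow> bool" where
  "markov_chain E p M S \<longleftrightarrow>
     countable E \<and> prob_space M \<and> (\<forall>n. S n \<in> measurable M (count_space E)) \<and>
     (\<forall>n x. \<forall>y\<in>E. \<P>(\<omega> in M. \<forall>i\<le>n. S i \<omega> = x i) > 0 \<longrightarrow>
        \<P>(\<omega> in M. S (Suc n) \<omega> = y \<bar> \<forall>i\<le>n. S i \<omega> = x i) = p (x n) y)"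

definition transient_chain :: "'s set \<Rightarrow> 'a measure \<Rightarrow> (nat \<Rightarrow> 'a \<Rightarrow> 's) \<Rightarrow> bool" where
  "transient_chain E M S \<longleftrightarrow> (AE \<omega> in M. \<forall>x\<in>E. finite {n. S n \<omega> = x})"

definition cutpoint :: "(nat \<Rightarrow> 's) \<Rightarrow> 's \<Rightarrow> bool" where
  "cutpoint s x \<longleftrightarrow> (\<exists>k. s k = x \<and> s ` {k<..} \<inter> s ` {..k} = {})"

text \<open>
  Used on the state space \<open>{1..}\<close> only; the values at \<open>0\<close>, and \<open>r 0\<close>, play no role.
\<close>

definition bd_transition :: "(nat \<Rightarrow> real) \<Rightarrow> nat \<Rightarrow> nat \<Rightarrow> real" where
  "bd_transition r k j =
     (if k = 1 then (if j = 2 then 1 else 0)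
      else if j = k + 1 then r (k - 1) / (r (k - 1) + r k)
      else if j = k - 1 then r k / (r (k - 1) + r k)
      else 0)"

end

theory Submission
  imports Defs
begin

text \<open>
  View the chain as the random walk on the half-line in which the edge from \<open>k\<close> to \<open>k + 1\<close> has
  resistance \<open>r k\<close>. The tails \<open>R x = (\<Sum>k\<ge>x. r k)\<close> are harmonic above \<open>1\<close>, which gives
  transience and shows that from \<open>y > x\<close> the walk stays above \<open>x\<close> forever with probability
  \<open>1 - R y / R x\<close>. A level \<open>x\<close> not below the start is a cutpoint iff the walk never returns to \<open>x\<close>
  after first hitting \<open>x + 1\<close>, so this has probability at most \<open>r x / R x\<close>, of order
  \<open>1 / (x log x)\<close>. The dyadic block from \<open>2^k\<close> thus has expected number of cutpoints of order
  \<open>1 / k\<close>, which is not summable. But if \<open>j\<close> is the first cutpoint of the block, then \<open>x > j\<close> is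
  one with conditional probability at least \<open>r x / (r j + ... + r x)\<close>, of order
  \<open>1 / (x - j + 1)\<close>: cutpoints come in clusters of expected size of order \<open>k\<close>. So the block
  contains a cutpoint with probability of order at most \<open>1 / k^2\<close>, and Borel-Cantelli applies.
\<close>

subsection \<open>One-step expectations\<close>

text \<open>Events of the natural filtration, encoded as predicates on trajectories; over a
  countable state space their measurability then follows from this dependence alone.\<close>

definition depends_upto :: "nat \<Rightarrow> ((nat \<Rightarrow> 's) \<Rightarrow> bool) \<Rightarrow> bool" where
  "depends_upto n H \<longleftrightarrow> (\<forall>s t. (\<forall>i\<le>n. s i = t i) \<longrightarrow> H s = H t)"

locale bd_chain = prob_space M for M :: "'a measure" +
  fixes r :: "nat \<Rightarrow> real" and S :: "nat \<Rightarrow> 'a \<Rightarrow> nat"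
  assumes r_pos: "\<And>k. k \<ge> 1 \<Longrightarrow> r k > 0"
    and r_summable: "summable r"
    and chain: "markov_chain {1..} (bd_transition r) M S"
begin

abbreviation path :: "'a \<Rightarrow> nat \<Rightarrow> nat" where
  "path \<omega> \<equiv> (\<lambda>n. S n \<omega>)"

text \<open>The transition operator of the chain. At \<open>k = 1\<close> the weight of
  \<open>k - 1\<close> is \<open>0\<close>, so the reflecting state needs no separate
  formula.\<close>

definition step_op :: "(nat \<Rightarrow> real) \<Rightarrow> nat \<Rightarrow> real" where
  "step_op f k = bd_transition r k (k + 1) * f (k + 1) + bd_transition r k (k - 1) * f (k - 1)"

lemma S_ge_1: "\<omega> \<in> space M \<Longrightarrow> S n \<omega> \<ge> 1"
  using chain measurable_space[of "S n" M "count_space {1..}" \<omega>]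
  by (auto simp: markov_chain_def)

lemma S_measurable[measurable]: "S n \<in> measurable M (count_space UNIV)"
proof -
  have "S n \<in> measurable M (count_space {1..})"
    using chain by (auto simp: markov_chain_def)
  from measurable_compose[OF this, of "\<lambda>x. x" "count_space UNIV"] show ?thesis by simp
qed

lemma prefix_measurable[measurable]:
  "(\<lambda>\<omega>. map (path \<omega>) [0..<n]) \<in> measurable M (count_space UNIV)"
proof (induction n)
  case (Suc n)
  have "(\<lambda>\<omega>. (map (path \<omega>) [0..<n], S n \<omega>)) \<in> measurable M (count_space UNIV)"
    using measurable_Pair[OF Suc S_measurable[of n]] by (simp add: pair_measure_countable)
  from measurable_compose[OF this, of "\<lambda>(l, y). l @ [y]" "count_space UNIV"]
  show ?case by simp
qed simp

text \<open>\<open>H\<close> factors through the list of the first \<open>n + 1\<close> values,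
  which lives in a countable discrete space where every map is measurable.\<close>

lemma depends_upto_measurable:
  assumes "depends_upto n H"
  shows "Measurable.pred M (\<lambda>\<omega>. H (path \<omega>))"
proof -
  have "H (path \<omega>) = H (\<lambda>i. map (path \<omega>) [0..<Suc n] ! i)" for \<omega>
    using assms unfolding depends_upto_def by (force simp del: upt_Suc)
  moreover have "Measurable.pred M (\<lambda>\<omega>. H (\<lambda>i. map (path \<omega>) [0..<Suc n] ! i))"
    by (rule measurable_compose[OF prefix_measurable[of "Suc n"]]) simp
  ultimately show ?thesis by simp
qed

text \<open>The Markov property in product form covers null histories too, since both sides are then
  \<open>0\<close>.\<close>

lemma prob_step:
  assumes "y \<ge> 1"
  shows "\<P>(\<omega> in M. (\<forall>i\<le>n. S i \<omega> = x i) \<and> S (Suc n) \<omega> = y)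
       = \<P>(\<omega> in M. \<forall>i\<le>n. S i \<omega> = x i) * bd_transition r (x n) y"
    (is "?L = ?R * _")
proof (cases "?R > 0")
  case True
  then have "\<P>(\<omega> in M. S (Suc n) \<omega> = y \<bar> \<forall>i\<le>n. S i \<omega> = x i) = bd_transition r (x n) y"
    using chain assms by (auto simp: markov_chain_def)
  with True show ?thesis
    by (simp add: cond_prob_def field_simps conj_commute)
next
  case False
  then have "?R = 0" using measure_nonneg[of M] by (simp add: less_le)
  moreover have "?L \<le> ?R" by (rule finite_measure_mono) auto
  ultimately show ?thesis using measure_nonneg[of M] by (simp add: antisym)
qed

lemma AE_nearest:
  "AE \<omega> in M. \<forall>n. S (Suc n) \<omega> = S n \<omega> + 1 \<or> S n \<omega> = S (Suc n) \<omega> + 1"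
proof -
  \<comment> \<open>Histories are indexed by lists rather than functions, so that only countably
    many null sets have to be discarded.\<close>
  have bad: "AE \<omega> in M. \<not> ((\<forall>i\<le>n. S i \<omega> = l ! i) \<and> S (Suc n) \<omega> = y)"
    if "y \<noteq> l ! n + 1" "l ! n \<noteq> y + 1" for n y and l :: "nat list"
  proof (cases "y \<ge> 1")
    case True
    have "\<P>(\<omega> in M. (\<forall>i\<le>n. S i \<omega> = l ! i) \<and> S (Suc n) \<omega> = y) = 0"
      using prob_step[OF True, of n "\<lambda>i. l ! i"] that True by (auto simp: bd_transition_def)
    then show ?thesis by (subst (asm) prob_eq_0) auto
  next
    case False
    then show ?thesis by (intro AE_I2) (use S_ge_1 in force)
  qed
  have "AE \<omega> in M. \<forall>n (l :: nat list) y. y \<noteq> l ! n + 1 \<longrightarrow> l ! n \<noteq> y + 1 \<longrightarrow>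
          \<not> ((\<forall>i\<le>n. S i \<omega> = l ! i) \<and> S (Suc n) \<omega> = y)"
    unfolding AE_all_countable using bad by auto
  then show ?thesis
  proof eventually_elim
    case (elim \<omega>)
    show ?case
    proof
      fix n
      show "S (Suc n) \<omega> = S n \<omega> + 1 \<or> S n \<omega> = S (Suc n) \<omega> + 1"
        using elim[rule_format, of "S (Suc n) \<omega>" "map (path \<omega>) [0..<Suc n]" n]
        by (cases "S (Suc n) \<omega> = Suc (S n \<omega>)") (auto simp del: upt_Suc)
    qed
  qed
qed

text \<open>
  \<open>from_nat\<close> is not injective on lists; the condition on \<open>to_nat\<close> makes the sets disjoint.
\<close>
lemma integral_atoms:
  fixes f :: "'a \<Rightarrow> real"
  assumes f: "integrable M f"
  shows "(\<integral>\<omega>. f \<omega> \<partial>M) =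
    (\<Sum>j. \<integral>\<omega>. indicator {\<omega>\<in>space M. map (path \<omega>) [0..<n] = from_nat j \<and> to_nat (map (path \<omega>) [0..<n]) = j} \<omega> * f \<omega> \<partial>M)"
proof -
  let ?A = "\<lambda>j. {\<omega>\<in>space M. map (path \<omega>) [0..<n] = from_nat j \<and> to_nat (map (path \<omega>) [0..<n]) = j}"
  have U: "(\<Union>j. ?A j) = space M" by auto
  have m: "?A j \<in> sets M" for j by measurable
  have "(LINT \<omega>:(\<Union>j. ?A j)|M. f \<omega>) = (\<Sum>j. (LINT \<omega>:?A j|M. f \<omega>))"
  proof (rule lebesgue_integral_countable_add)
    show "set_integrable M (\<Union>j. ?A j) f"
      unfolding U set_integrable_def using f by (subst Bochner_Integration.integrable_cong[where g=f]) auto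
  qed (use m in auto)
  then show ?thesis
    unfolding U using f by (simp add: set_integral_space) (simp add: set_lebesgue_integral_def)
qed

text \<open>The Markov property for bounded \<open>f\<close>: split by the first
  \<open>n + 1\<close> values. On each atom \<open>H\<close> and \<open>S n\<close> are constant,
  and almost surely only two successors occur.\<close>

lemma integral_step:
  assumes H: "depends_upto n H" and f: "\<And>x. \<bar>f x\<bar> \<le> B"
  shows "(\<integral>\<omega>. (if H (path \<omega>) then f (S (Suc n) \<omega>) else 0) \<partial>M)
       = (\<integral>\<omega>. (if H (path \<omega>) then step_op f (S n \<omega>) else 0) \<partial>M)"
proof -
  have [measurable]: "Measurable.pred M (\<lambda>\<omega>. H (path \<omega>))"
    by (rule depends_upto_measurable[OF H])
  have fm[measurable]: "(\<lambda>\<omega>. f (S m \<omega>)) \<in> borel_measurable M" for m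
    by (rule measurable_compose[OF S_measurable]) simp
  have sm[measurable]: "(\<lambda>\<omega>. step_op f (S m \<omega>)) \<in> borel_measurable M" for m
    by (rule measurable_compose[OF S_measurable]) simp
  have B0: "B \<ge> 0" using f[of 0] by simp
  have bd1: "\<bar>bd_transition r k j\<bar> \<le> 1" if "k \<ge> 1" for k j
  proof (cases "k = 1")
    case False
    then have "r (k - 1) > 0" "r k > 0" using that r_pos by auto
    then show ?thesis by (auto simp: bd_transition_def)
  qed (auto simp: bd_transition_def)
  have prod: "\<bar>bd_transition r k j * f j\<bar> \<le> B" if "k \<ge> 1" for k j
    unfolding abs_mult using mult_mono[OF bd1[OF that, of j] f[of j]] B0 by simp
  have sb: "\<bar>step_op f k\<bar> \<le> 2 * B" if "k \<ge> 1" for k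
    using prod[OF that, of "k + 1"] prod[OF that, of "k - 1"] unfolding step_op_def by linarith
  have i1: "integrable M (\<lambda>\<omega>. if H (path \<omega>) then f (S (Suc n) \<omega>) else 0)"
    by (rule integrable_const_bound[where B=B]) (use f B0 in auto)
  have i2: "integrable M (\<lambda>\<omega>. if H (path \<omega>) then step_op f (S n \<omega>) else 0)"
    by (rule integrable_const_bound[where B="2*B"], rule AE_I2) (use sb B0 S_ge_1 in auto)
  show ?thesis
    unfolding integral_atoms[OF i1, of "Suc n"] integral_atoms[OF i2, of "Suc n"]
  proof (rule suminf_cong)
    fix j
    define l :: "nat list" where "l = from_nat j"
    let ?A = "{\<omega>\<in>space M. map (path \<omega>) [0..<Suc n] = from_nat j \<and> to_nat (map (path \<omega>) [0..<Suc n]) = j}"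
    let ?B = "{\<omega>\<in>space M. \<forall>i\<le>n. S i \<omega> = l ! i}"
    let ?C = "\<lambda>y. {\<omega>\<in>space M. (\<forall>i\<le>n. S i \<omega> = l ! i) \<and> S (Suc n) \<omega> = y}"
    let ?I = "\<lambda>g. (\<integral>\<omega>. indicator ?A \<omega> * (if H (path \<omega>) then g \<omega> else (0::real)) \<partial>M)"
    show "?I (\<lambda>\<omega>. f (S (Suc n) \<omega>)) = ?I (\<lambda>\<omega>. step_op f (S n \<omega>))"
    proof (cases "length l = Suc n \<and> to_nat l = j \<and> H (\<lambda>i. l ! i)")
      case False
      \<comment> \<open>Here the list has the wrong length, is not canonically coded by
        \<open>j\<close>, or violates \<open>H\<close>; both integrands vanish pointwise.\<close>
      have "indicator ?A \<omega> * (if H (path \<omega>) then c else (0::real)) = 0" for \<omega> c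
      proof -
        { assume a: "\<omega> \<in> ?A"
          then have l: "l = map (path \<omega>) [0..<Suc n]" by (simp add: l_def)
          have "H (path \<omega>) = H (\<lambda>i. l ! i)"
            unfolding l by (rule H[unfolded depends_upto_def, rule_format]) (simp del: upt_Suc)
          with False a l have "\<not> H (path \<omega>)" by auto }
        then show ?thesis by (auto simp: indicator_def)
      qed
      then show ?thesis by (simp only:)
    next
      case True
      have AB: "?A = ?B"
        using True by (auto simp: l_def[symmetric] list_eq_iff_nth_eq less_Suc_eq_le simp del: upt_Suc)
      have Hl: "H (path \<omega>)" if "\<omega> \<in> ?B" for \<omega>
      proof -
        have "H (path \<omega>) = H (\<lambda>i. l ! i)"
          by (rule H[unfolded depends_upto_def, rule_format]) (use that in auto)
        with True show ?thesis by simp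
      qed
      define k where "k = l ! n"
      have Cm: "?C y \<in> sets M" for y by measurable
      have Bm: "?B \<in> sets M" by measurable
      \<comment> \<open>The guard concerns \<open>k = 0\<close>, where truncated subtraction gives
        \<open>k - 1 = k\<close>; then \<open>?B\<close> is empty because the chain stays at or
        above \<open>1\<close>.\<close>
      have "?I (\<lambda>\<omega>. f (S (Suc n) \<omega>)) =
          (\<integral>\<omega>. f (k+1) * indicator (?C (k+1)) \<omega> + (if k \<ge> 1 then f (k-1) else 0) * indicator (?C (k-1)) \<omega> \<partial>M)"
        unfolding AB
      proof (rule integral_cong_AE)
        show "AE \<omega> in M. indicator ?B \<omega> * (if H (path \<omega>) then f (S (Suc n) \<omega>) else 0) =
            f (k+1) * indicator (?C (k+1)) \<omega> + (if k \<ge> 1 then f (k-1) else 0) * indicator (?C (k-1)) \<omega>"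
          using AE_nearest
        proof eventually_elim
          case (elim \<omega>)
          then have "S (Suc n) \<omega> = S n \<omega> + 1 \<or> S n \<omega> = S (Suc n) \<omega> + 1" by blast
          then show ?case using Hl[of \<omega>] by (auto simp: indicator_def k_def)
        qed
      qed measurable
      also have "\<dots> = f (k+1) * measure M (?C (k+1)) + (if k \<ge> 1 then f (k-1) else 0) * measure M (?C (k-1))"
        using Cm by (subst Bochner_Integration.integral_add) (auto intro!: integrable_mult_right simp: measure_def[symmetric] emeasure_eq_measure)
      also have "\<dots> = step_op f k * measure M ?B"
      proof -
        have 1: "measure M (?C (k+1)) = measure M ?B * bd_transition r k (k+1)"
          using prob_step[of "k+1" n "\<lambda>i. l ! i"] by (simp add: k_def)
        have 2: "measure M (?C (k-1)) = measure M ?B * bd_transition r k (k-1)" if "k \<ge> 1"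
        proof (cases "k = 1")
          case True
          then have "?C (k-1) = {}" using S_ge_1[of _ "Suc n"] by force
          then have "measure M (?C (k-1)) = 0" by (metis measure_empty)
          then show ?thesis using True by (simp add: bd_transition_def)
        next
          case False
          then show ?thesis using that prob_step[of "k-1" n "\<lambda>i. l ! i"] by (simp add: k_def)
        qed
        show ?thesis
        proof (cases "k \<ge> 1")
          case True
          then show ?thesis using 1 2[OF True] by (simp add: step_op_def algebra_simps)
        next
          case False
          then have "?B = {}" using S_ge_1[of _ n] by (force simp: k_def)
          then have "measure M ?B = 0" by (metis measure_empty)
          then show ?thesis using 1 False by simp
        qed
      qed
      also have "\<dots> = (\<integral>\<omega>. step_op f k * indicator ?B \<omega> \<partial>M)"
        using Bm by simp
      also have "\<dots> = ?I (\<lambda>\<omega>. step_op f (S n \<omega>))"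
        unfolding AB by (rule Bochner_Integration.integral_cong) (use Hl in \<open>auto simp: indicator_def k_def\<close>)
      finally show ?thesis .
    qed
  qed
qed

end

subsection \<open>Transience and escape probabilities\<close>

context bd_chain
begin

text \<open>The function \<open>R\<close> of the introduction. As a total minus a partial sum, its
  differences are finite sums by algebra alone.\<close>

definition tail :: "nat \<Rightarrow> real" where
  "tail y = suminf r - sum r {..<y}"

text \<open>Gambler's ruin with the upper barrier at infinity: for \<open>y > x\<close>, the chance
  that the walk from \<open>y\<close> never hits \<open>x\<close>, as \<open>prob_stay_above\<close>
  confirms.\<close>

definition escape :: "nat \<Rightarrow> nat \<Rightarrow> real" where
  "escape x y = 1 - tail y / tail x"

lemma tail_Suc: "tail y = r y + tail (Suc y)"
  by (simp add: tail_def)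

lemma tail_diff: "x \<le> y \<Longrightarrow> tail x - tail y = sum r {x..<y}"
  by (induction y rule: dec_induct) (simp_all add: tail_def algebra_simps)

lemma tail_ge_sum:
  assumes "x \<ge> 1"
  shows "tail x \<ge> sum r {x..<y}"
proof (cases "x \<le> y")
  case True
  have "sum r {..<y} \<le> suminf r"
    by (rule sum_le_suminf[OF r_summable]) (use True assms r_pos in \<open>force intro: less_imp_le\<close>)+
  then show ?thesis using tail_diff[OF True] by (simp add: tail_def)
next
  case False
  have "sum r {..<x} \<le> suminf r"
    by (rule sum_le_suminf[OF r_summable]) (use assms r_pos in \<open>force intro: less_imp_le\<close>)+
  then show ?thesis using False by (simp add: tail_def)
qed

lemma tail_pos: "x \<ge> 1 \<Longrightarrow> tail x > 0"
  using tail_ge_sum[of x "Suc x"] r_pos[of x] by simp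

lemma tail_antimono: "1 \<le> x \<Longrightarrow> x \<le> y \<Longrightarrow> tail y \<le> tail x"
  using tail_diff[of x y] r_pos sum_nonneg[of "{x..<y}" r] by (force intro: less_imp_le)

lemma tail_tendsto_0: "tail \<longlonglongrightarrow> 0"
  using tendsto_diff[OF tendsto_const summable_LIMSEQ[OF r_summable], of "suminf r"]
  by (simp add: tail_def[abs_def])

lemma escape_Suc: "x \<ge> 1 \<Longrightarrow> escape x (Suc x) = r x / tail x"
  using tail_pos[of x] tail_Suc[of x] by (simp add: escape_def field_simps)

lemma escape_sum: "1 \<le> x \<Longrightarrow> x \<le> y \<Longrightarrow> escape x y = sum r {x..<y} / tail x"
  using tail_pos[of x] tail_diff[of x y] by (simp add: escape_def field_simps)

lemma escape_bounds: "1 \<le> x \<Longrightarrow> x \<le> y \<Longrightarrow> 0 \<le> escape x y \<and> escape x y \<le> 1"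
  using tail_pos[of x] tail_pos[of y] tail_antimono[of x y] by (simp add: escape_def)

lemma bd_transition_sum:
  "k \<ge> 1 \<Longrightarrow> bd_transition r k (k + 1) + bd_transition r k (k - 1) = 1"
proof (cases "k = 1")
  case False
  assume "k \<ge> 1"
  with False have "r (k - 1) > 0" "r k > 0" using r_pos by auto
  then show ?thesis using False \<open>k \<ge> 1\<close> by (auto simp: bd_transition_def add_divide_distrib[symmetric])
qed (simp add: bd_transition_def)

text \<open>The increments of \<open>tail\<close> next to \<open>k\<close> are
  \<open>r (k - 1)\<close> and \<open>r k\<close>, with jump weights proportional to
  \<open>r k\<close> and \<open>r (k - 1)\<close>, so they balance. Only the two neighbours of
  \<open>k\<close> enter, which admits truncated functions.\<close>

lemma step_op_harmonic:
  assumes "k \<ge> 2" "f (k + 1) = a + b * tail (k + 1)" "f (k - 1) = a + b * tail (k - 1)"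
  shows "step_op f k = a + b * tail k"
proof -
  have p: "r (k - 1) > 0" "r k > 0" using assms(1) r_pos by auto
  have t: "tail (k + 1) = tail k - r k" "tail (k - 1) = r (k - 1) + tail k"
    using tail_Suc[of k] tail_Suc[of "k - 1"] assms(1) by simp_all
  have u: "bd_transition r k (k + 1) = r (k - 1) / (r (k - 1) + r k)"
    "bd_transition r k (k - 1) = r k / (r (k - 1) + r k)"
    using assms(1) by (auto simp: bd_transition_def)
  have "r (k - 1) + r k \<noteq> 0" using p by simp
  then show ?thesis
    unfolding step_op_def assms(2,3) t u by (simp add: divide_simps) (simp add: algebra_simps)
qed

text \<open>Above \<open>k\<close> the function coincides with the harmonic \<open>tail\<close>,
  below \<open>k\<close> it is locally constant, and at \<open>k\<close> only the upward step
  changes it, by \<open>- r k\<close>.\<close>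

lemma step_op_truncated:
  assumes "k \<ge> 1" "y \<ge> 1"
  shows "step_op (\<lambda>y. tail (max y k)) y =
    tail (max y k) - (if y = k then bd_transition r k (k + 1) * r k else 0)"
proof -
  consider "y > k" | "y = k" | "y < k" by linarith
  then show ?thesis
  proof cases
    case 1
    then have "k \<le> y - 1" by simp
    with 1 assms have "step_op (\<lambda>y. tail (max y k)) y = 0 + 1 * tail y"
      by (intro step_op_harmonic) (auto simp: max_def)
    with 1 show ?thesis by simp
  next
    case 2
    have "step_op (\<lambda>y. tail (max y k)) y
        = bd_transition r k (k + 1) * tail (k + 1) + bd_transition r k (k - 1) * tail k"
      using 2 by (simp add: step_op_def max_def)
    also have "tail (k + 1) = tail k - r k" using tail_Suc[of k] by simp
    also have "bd_transition r k (k - 1) = 1 - bd_transition r k (k + 1)"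
      using bd_transition_sum[of k] assms by simp
    finally show ?thesis using 2 by (simp add: algebra_simps)
  next
    case 3
    then have "max (y + 1) k = k" "max (y - 1) k = k" "max y k = k" by auto
    then have "step_op (\<lambda>y. tail (max y k)) y
        = (bd_transition r y (y + 1) + bd_transition r y (y - 1)) * tail k"
      by (simp add: step_op_def algebra_simps)
    then show ?thesis using 3 assms bd_transition_sum[of y] by simp
  qed
qed

text \<open>
  The nonnegative function \<open>y \<mapsto> R (max y k)\<close> is superharmonic, with a strict drop only at \<open>k\<close>:
  each visit to \<open>k\<close> costs a fixed amount of its bounded expectation.
\<close>
lemma summable_prob_visit:
  assumes k: "k \<ge> 1"
  shows "summable (\<lambda>n. \<P>(\<omega> in M. S n \<omega> = k))"
proof -
  define f where "f y = tail (max y k)" for y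
  define e where "e = bd_transition r k (k + 1) * r k"
  have e: "e > 0"
  proof (cases "k = 1")
    case False
    then have "r (k - 1) > 0" "r k > 0" using k r_pos by auto
    with False show ?thesis by (simp add: e_def bd_transition_def)
  qed (use r_pos[of 1] in \<open>simp add: e_def bd_transition_def\<close>)
  have f: "0 \<le> f y" "f y \<le> tail k" for y
    using k tail_pos[of "max y k"] tail_antimono[of k "max y k"] by (simp_all add: f_def max.coboundedI2)
  have fm[measurable]: "(\<lambda>\<omega>. f (S n \<omega>)) \<in> borel_measurable M" for n
    by (rule measurable_compose[OF S_measurable]) simp
  have fi: "integrable M (\<lambda>\<omega>. f (S n \<omega>))" for n
    by (rule integrable_const_bound[where B="tail k"]) (use f in auto)
  let ?E = "\<lambda>n. {\<omega>\<in>space M. S n \<omega> = k}"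
  have em: "?E n \<in> sets M" for n by measurable
  have step: "(\<integral>\<omega>. f (S (Suc n) \<omega>) \<partial>M) = (\<integral>\<omega>. f (S n \<omega>) \<partial>M) - e * measure M (?E n)" for n
  proof -
    have "(\<integral>\<omega>. f (S (Suc n) \<omega>) \<partial>M) = (\<integral>\<omega>. step_op f (S n \<omega>) \<partial>M)"
      using integral_step[of n "\<lambda>_. True" f "tail k"] f by (simp add: depends_upto_def)
    also have "\<dots> = (\<integral>\<omega>. f (S n \<omega>) - e * indicator (?E n) \<omega> \<partial>M)"
      by (rule Bochner_Integration.integral_cong)
        (use step_op_truncated[OF k S_ge_1] in \<open>auto simp: f_def[abs_def] e_def indicator_def\<close>)
    also have "\<dots> = (\<integral>\<omega>. f (S n \<omega>) \<partial>M) - e * measure M (?E n)"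
      using em fi by (subst Bochner_Integration.integral_diff) (auto simp: emeasure_eq_measure)
    finally show ?thesis .
  qed
  \<comment> \<open>Telescoping in time: \<open>e\<close> times the expected number of visits before
    \<open>N\<close> is a loss of expectation, hence at most \<open>tail k\<close>.\<close>
  have "e * (\<Sum>n<N. measure M (?E n)) = (\<integral>\<omega>. f (S 0 \<omega>) \<partial>M) - (\<integral>\<omega>. f (S N \<omega>) \<partial>M)" for N
  proof (induction N)
    case (Suc N)
    then show ?case using step[of N] by (simp add: algebra_simps)
  qed simp
  moreover have "(\<integral>\<omega>. f (S 0 \<omega>) \<partial>M) \<le> tail k"
    using integral_mono[OF fi[of 0], of "\<lambda>_. tail k"] f by (simp add: prob_space)
  moreover have "(\<integral>\<omega>. f (S N \<omega>) \<partial>M) \<ge> 0" for N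
    using f by (intro integral_nonneg_AE) auto
  ultimately have "e * (\<Sum>n<N. measure M (?E n)) \<le> tail k" for N
    by (smt (verit))
  then have "(\<Sum>n<N. measure M (?E n)) \<le> tail k / e" for N
    using e by (simp add: pos_le_divide_eq mult.commute)
  then show ?thesis
    by (intro bounded_imp_summable[where B="tail k / e"])
      (auto simp: lessThan_Suc_atMost[symmetric] simp del: sum.lessThan_Suc)
qed

lemma AE_finite_visits: "AE \<omega> in M. \<forall>k\<ge>1. finite {n. S n \<omega> = k}"
proof -
  have "AE \<omega> in M. k \<ge> 1 \<longrightarrow> finite {n. S n \<omega> = k}" for k
  proof (cases "k \<ge> 1")
    case True
    have "AE \<omega> in M. eventually (\<lambda>n. \<omega> \<in> space M - {\<omega>\<in>space M. S n \<omega> = k}) sequentially"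
    proof (rule borel_cantelli_AE1)
      show "{\<omega>\<in>space M. S n \<omega> = k} \<in> sets M" for n by measurable
    qed (use summable_prob_visit[OF True] in \<open>simp_all add: emeasure_eq_measure\<close>)
    then show ?thesis
      using AE_space
    proof eventually_elim
      case (elim \<omega>)
      then obtain N where "\<forall>n\<ge>N. S n \<omega> \<noteq> k"
        unfolding eventually_sequentially by auto
      then have "{n. S n \<omega> = k} \<subseteq> {..<N}" by (force simp: not_le[symmetric])
      then show ?case using finite_subset by auto
    qed
  qed simp
  then show ?thesis unfolding AE_all_countable by blast
qed

text \<open>Below any bound there are only finitely many states, each visited finitely
  often.\<close>

lemma AE_to_infinity: "AE \<omega> in M. filterlim (path \<omega>) at_top sequentially"
  using AE_finite_visits AE_space
proof eventually_elim
  case (elim \<omega>)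
  show ?case
    unfolding filterlim_at_top
  proof
    fix Z
    have "finite (\<Union>k\<in>{1..Z}. {n. S n \<omega> = k})" using elim by auto
    then obtain N where N: "\<forall>n\<in>(\<Union>k\<in>{1..Z}. {n. S n \<omega> = k}). n < N"
      using finite_nat_set_iff_bounded by blast
    have "Z \<le> S n \<omega>" if "n \<ge> N" for n
    proof (rule ccontr)
      assume "\<not> Z \<le> S n \<omega>"
      then have "n \<in> (\<Union>k\<in>{1..Z}. {n. S n \<omega> = k})"
        using S_ge_1[OF elim(2), of n] by simp
      with N that show False by (metis not_le)
    qed
    then show "eventually (\<lambda>n. Z \<le> S n \<omega>) sequentially"
      unfolding eventually_sequentially by blast
  qed
qed

text \<open>
  \<open>escape x\<close> vanishes at \<open>x\<close>, so along paths killed when they leave \<open>{x<..}\<close> it is a bounded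
  martingale, and by transience it converges to the indicator of survival.
\<close>
lemma prob_stay_above:
  assumes x: "x \<ge> 1" and H: "depends_upto n H" and Hx: "\<And>s. H s \<Longrightarrow> s n = y" and y: "y > x"
  shows "\<P>(\<omega> in M. H (path \<omega>) \<and> (\<forall>i\<ge>n. S i \<omega> > x)) = \<P>(\<omega> in M. H (path \<omega>)) * escape x y"
proof -
  \<comment> \<open>Since \<open>escape x x = 0\<close>, cutting off at \<open>x\<close> keeps
    \<open>f\<close> harmonic even at \<open>x + 1\<close>.\<close>
  define f where "f z = (if z > x then escape x z else 0)" for z
  define K where "K m s \<longleftrightarrow> H s \<and> (\<forall>i. n \<le> i \<and> i \<le> n + m \<longrightarrow> s i > x)" for m and s :: "nat \<Rightarrow> nat"
  have Hm[measurable]: "Measurable.pred M (\<lambda>\<omega>. H (path \<omega>))"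
    by (rule depends_upto_measurable[OF H])
  have Kh: "depends_upto (n + m) (K m)" for m
    unfolding depends_upto_def K_def
  proof safe
    fix s t :: "nat \<Rightarrow> nat" and i
    assume a: "\<forall>i\<le>n + m. s i = t i"
    then have st: "H s = H t" using H unfolding depends_upto_def by auto
    { assume "H s" then show "H t" using st by simp }
    { assume "H t" then show "H s" using st by simp }
    assume *: "n \<le> i" "i \<le> n + m"
    { assume "\<forall>i. n \<le> i \<and> i \<le> n + m \<longrightarrow> x < s i" then show "x < t i" using a * by metis }
    { assume "\<forall>i. n \<le> i \<and> i \<le> n + m \<longrightarrow> x < t i" then show "x < s i" using a * by metis }
  qed
  have Km[measurable]: "Measurable.pred M (\<lambda>\<omega>. K m (path \<omega>))" for m
    by (rule depends_upto_measurable[OF Kh])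
  have f: "\<bar>f z\<bar> \<le> 1" for z
    using escape_bounds[OF x, of z] by (auto simp: f_def)
  have fm[measurable]: "(\<lambda>\<omega>. f (S m \<omega>)) \<in> borel_measurable M" for m
    by (rule measurable_compose[OF S_measurable]) simp
  have harm: "step_op f z = f z" if "z > x" for z
  proof -
    have "f (z - 1) = 1 + (- 1 / tail x) * tail (z - 1)"
      using that x tail_pos[OF x] by (cases "z - 1 = x") (auto simp: f_def escape_def)
    then have "step_op f z = 1 + (- 1 / tail x) * tail z"
      using that x by (intro step_op_harmonic) (auto simp: f_def escape_def)
    then show ?thesis using that by (simp add: f_def escape_def)
  qed
  let ?X = "\<lambda>m \<omega>. if K m (path \<omega>) then f (S (n + m) \<omega>) else 0"
  have const: "(\<integral>\<omega>. ?X m \<omega> \<partial>M) = \<P>(\<omega> in M. H (path \<omega>)) * escape x y" for m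
  proof (induction m)
    case 0
    have K0: "K 0 s \<longleftrightarrow> H s" for s
      unfolding K_def using Hx[of s] y by (metis add_0_right le_antisym)
    have "?X 0 \<omega> = escape x y * indicator {\<omega>\<in>space M. H (path \<omega>)} \<omega>" if "\<omega> \<in> space M" for \<omega>
      using that Hx[of "path \<omega>"] y by (auto simp: K0 f_def)
    then have "(\<integral>\<omega>. ?X 0 \<omega> \<partial>M) = (\<integral>\<omega>. escape x y * indicator {\<omega>\<in>space M. H (path \<omega>)} \<omega> \<partial>M)"
      by (intro Bochner_Integration.integral_cong) auto
    also have "\<dots> = escape x y * measure M {\<omega>\<in>space M. H (path \<omega>)}" by simp
    finally show ?case by simp
  next
    case (Suc m)
    \<comment> \<open>\<open>f\<close> vanishes off \<open>{x<..}\<close>, so the survival condition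
      at the new time may be dropped before the one-step formula is applied.\<close>
    have "(\<integral>\<omega>. ?X (Suc m) \<omega> \<partial>M)
        = (\<integral>\<omega>. (if K m (path \<omega>) then f (S (Suc (n + m)) \<omega>) else 0) \<partial>M)"
      by (rule Bochner_Integration.integral_cong) (auto simp: K_def f_def le_Suc_eq)
    also have "\<dots> = (\<integral>\<omega>. (if K m (path \<omega>) then step_op f (S (n + m) \<omega>) else 0) \<partial>M)"
      by (rule integral_step[OF Kh f])
    also have "\<dots> = (\<integral>\<omega>. ?X m \<omega> \<partial>M)"
      by (rule Bochner_Integration.integral_cong) (use harm in \<open>auto simp: K_def\<close>)
    finally show ?case using Suc by simp
  qed
  let ?L = "{\<omega>\<in>space M. H (path \<omega>) \<and> (\<forall>i\<ge>n. S i \<omega> > x)}"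
  have Lm: "?L \<in> sets M" by measurable
  have "(\<lambda>m. \<integral>\<omega>. ?X m \<omega> \<partial>M) \<longlonglongrightarrow> (\<integral>\<omega>. indicator ?L \<omega> \<partial>M)"
  proof (rule integral_dominated_convergence[where w="\<lambda>_. 1"])
    show "AE \<omega> in M. (\<lambda>m. ?X m \<omega>) \<longlonglongrightarrow> indicator ?L \<omega>"
      using AE_to_infinity AE_space
    proof eventually_elim
      case (elim \<omega>)
      show ?case
      proof (cases "\<omega> \<in> ?L")
        case True
        \<comment> \<open>A surviving path tends to infinity, where \<open>escape x\<close> tends to
          \<open>1\<close>; any other path is killed at a finite time and contributes
          \<open>0\<close> from then on.\<close>
        have "filterlim (\<lambda>m. S (m + n) \<omega>) at_top sequentially"
          using filterlim_compose[OF elim(1) filterlim_add_const_nat_at_top] .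
        from filterlim_compose[OF tail_tendsto_0 this]
        have "(\<lambda>m. 1 - tail (S (m + n) \<omega>) / tail x) \<longlonglongrightarrow> 1 - 0 / tail x"
          by (intro tendsto_intros) (use tail_pos[OF x] in auto)
        moreover have "?X m \<omega> = 1 - tail (S (m + n) \<omega>) / tail x" for m
          using True by (auto simp: K_def f_def escape_def add.commute)
        ultimately show ?thesis using True by simp
      next
        case False
        have "eventually (\<lambda>m. \<not> K m (path \<omega>)) sequentially"
        proof (cases "H (path \<omega>)")
          case True
          with False elim obtain i where "i \<ge> n" "\<not> S i \<omega> > x" by auto
          then have "\<not> K m (path \<omega>)" if "m \<ge> i" for m
            using that by (auto simp: K_def intro!: exI[of _ i])
          then show ?thesis unfolding eventually_sequentially by blast
        qed (simp add: K_def)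
        then have "eventually (\<lambda>m. ?X m \<omega> = 0) sequentially"
          by eventually_elim simp
        then show ?thesis using False by (simp add: tendsto_eventually)
      qed
    qed
  qed (use Lm f in auto)
  then have "(\<integral>\<omega>. indicator ?L \<omega> \<partial>M) = \<P>(\<omega> in M. H (path \<omega>)) * escape x y"
    unfolding const by (simp add: LIMSEQ_const_iff)
  then show ?thesis using Lm by simp
qed

end

subsection \<open>Cutpoints\<close>

text \<open>Earlier values must be below \<open>y\<close>, not merely different from it: a start
  above \<open>y\<close> has no first hit, and hits are ordered by level without any assumption on
  the steps.\<close>

definition first_hit :: "(nat \<Rightarrow> nat) \<Rightarrow> nat \<Rightarrow> nat \<Rightarrow> bool" where
  "first_hit s y m \<longleftrightarrow> s m = y \<and> (\<forall>i<m. s i < y)"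

text \<open>
  The first hit is that of \<open>x + 1\<close>, not of \<open>x\<close>: a cutpoint may be visited several times before
  the walk leaves it for good.
\<close>
definition cut_level :: "(nat \<Rightarrow> nat) \<Rightarrow> nat \<Rightarrow> bool" where
  "cut_level s x \<longleftrightarrow> (\<exists>m. first_hit s (Suc x) m \<and> (\<forall>i\<ge>m. s i > x))"

text \<open>The part of \<open>cut_level\<close> that is already decided at time
  \<open>m\<close>.\<close>

definition cut_level_until :: "nat \<Rightarrow> (nat \<Rightarrow> nat) \<Rightarrow> nat \<Rightarrow> bool" where
  "cut_level_until m s x \<longleftrightarrow>
     (\<exists>n\<le>m. first_hit s (Suc x) n \<and> (\<forall>i. n \<le> i \<and> i \<le> m \<longrightarrow> s i > x))"

definition first_cut :: "nat \<Rightarrow> (nat \<Rightarrow> nat) \<Rightarrow> nat \<Rightarrow> bool" where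
  "first_cut a s j \<longleftrightarrow> cut_level s j \<and> (\<forall>i\<in>{a..<j}. \<not> cut_level s i)"

lemma first_hit_mono: "first_hit s y m \<Longrightarrow> first_hit s z n \<Longrightarrow> y \<le> z \<Longrightarrow> m \<le> n"
  unfolding first_hit_def by (metis le_less_trans less_irrefl not_le)

lemma first_hit_unique: "first_hit s y m \<Longrightarrow> first_hit s y n \<Longrightarrow> m = n"
  using first_hit_mono by (metis le_antisym order_refl)

text \<open>Steps of size one cannot jump over \<open>y\<close>, so the first time at or above
  \<open>y\<close> is a hit.\<close>

lemma first_hit_exists:
  assumes near: "\<And>n. s (Suc n) = s n + 1 \<or> s n = s (Suc n) + 1"
    and inf: "filterlim s at_top sequentially" and le: "s 0 \<le> y"
  shows "\<exists>m. first_hit s y m"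
proof -
  define m where "m = (LEAST m. s m \<ge> y)"
  have "\<exists>m. s m \<ge> y"
    using inf by (auto simp: filterlim_at_top eventually_sequentially)
  then have m: "s m \<ge> y" unfolding m_def by (rule LeastI_ex)
  have below: "s i < y" if "i < m" for i
    using not_less_Least[of i "\<lambda>m. s m \<ge> y"] that by (simp add: m_def)
  have "s m \<le> y"
  proof (cases m)
    case (Suc k)
    then show ?thesis using below[of k] near[of k] by auto
  qed (use le in simp)
  with m below show ?thesis by (auto simp: first_hit_def)
qed

text \<open>After time \<open>k\<close> the path avoids \<open>x\<close>. A value below
  \<open>x\<close> would force a return to \<open>x\<close> on the way to infinity, so the path
  stays above \<open>x\<close>.\<close>

lemma cutpoint_imp_cut_level:
  assumes near: "\<And>n. s (Suc n) = s n + 1 \<or> s n = s (Suc n) + 1"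
    and inf: "filterlim s at_top sequentially" and le: "s 0 \<le> x" and cut: "cutpoint s x"
  shows "cut_level s x"
proof -
  from cut obtain k where k: "s k = x" and disj: "s ` {k<..} \<inter> s ` {..k} = {}"
    by (auto simp: cutpoint_def)
  have ne: "s i \<noteq> s l" if "i > k" "l \<le> k" for i l
    using disj that by blast
  have above: "s i > x" if "i > k" for i
  proof (rule ccontr)
    assume "\<not> s i > x"
    moreover have "filterlim (\<lambda>m. s (i + m)) at_top sequentially"
      using filterlim_compose[OF inf filterlim_add_const_nat_at_top[of i]] by (simp add: add.commute)
    ultimately obtain m where "first_hit (\<lambda>m. s (i + m)) x m"
      using first_hit_exists[of "\<lambda>m. s (i + m)" x] near by auto
    then have "s (i + m) = x" by (simp add: first_hit_def)
    with ne[of "i + m" k] k that show False by simp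
  qed
  have step: "s (Suc k) = Suc x"
    using above[of "Suc k"] near[of k] k by auto
  obtain m where m: "first_hit s (Suc x) m"
    using first_hit_exists[OF near inf, of "Suc x"] le by auto
  \<comment> \<open>The value \<open>x + 1\<close>, taken at \<open>k + 1\<close>, cannot occur up
    to time \<open>k\<close>, by disjointness.\<close>
  have "m > k"
    using ne[of "Suc k" m] step m by (force simp: first_hit_def)
  with above m show ?thesis unfolding cut_level_def by (metis less_le_trans)
qed

text \<open>For \<open>i \<le> x\<close> the first hit of \<open>i + 1\<close> comes no later than
  \<open>m\<close>, so the condition splits into a past and a future part.\<close>

lemma cut_level_iff:
  assumes m: "first_hit s (Suc x) m" and ix: "i \<le> x"
  shows "cut_level s i \<longleftrightarrow> cut_level_until m s i \<and> (\<forall>l\<ge>m. s l > i)"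
proof
  assume "cut_level s i"
  then obtain n where n: "first_hit s (Suc i) n" "\<forall>l\<ge>n. s l > i"
    by (auto simp: cut_level_def)
  moreover have "n \<le> m" using first_hit_mono[OF n(1) m] ix by simp
  ultimately show "cut_level_until m s i \<and> (\<forall>l\<ge>m. s l > i)"
    unfolding cut_level_until_def by (meson order_trans)
next
  assume "cut_level_until m s i \<and> (\<forall>l\<ge>m. s l > i)"
  then show "cut_level s i"
    unfolding cut_level_until_def cut_level_def by (metis nat_le_linear)
qed

text \<open>Staying above \<open>j\<close> after \<open>m\<close> implies staying above every lower
  level. Given this, the status of all levels up to \<open>j\<close> is decided by time
  \<open>m\<close>.\<close>

lemma first_cut_iff:
  assumes m: "first_hit s (Suc x) m" and jx: "j \<le> x"
  shows "first_cut a s j \<longleftrightarrow>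
    (cut_level_until m s j \<and> (\<forall>i\<in>{a..<j}. \<not> cut_level_until m s i)) \<and> (\<forall>l\<ge>m. s l > j)"
proof -
  have "cut_level s i \<longleftrightarrow> cut_level_until m s i \<and> (\<forall>l\<ge>m. s l > i)" if "i \<le> j" for i
    using cut_level_iff[OF m, of i] that jx by simp
  note * = this
  show ?thesis
  proof (cases "\<forall>l\<ge>m. s l > j")
    case True
    then have "cut_level s i \<longleftrightarrow> cut_level_until m s i" if "i \<le> j" for i
      using *[OF that] that by (meson le_less_trans)
    with True show ?thesis by (simp add: first_cut_def)
  next
    case False
    with *[of j] show ?thesis by (auto simp: first_cut_def)
  qed
qed

lemma first_hit_cong: "(\<forall>i\<le>m. s i = t i) \<Longrightarrow> n \<le> m \<Longrightarrow> first_hit s y n = first_hit t y n"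
  by (simp add: first_hit_def)

lemma cut_level_until_cong:
  "(\<forall>i\<le>m. s i = t i) \<Longrightarrow> cut_level_until m s x = cut_level_until m t x"
  unfolding cut_level_until_def using first_hit_cong[of m s t] by (metis (no_types, lifting))

section \<open>Probabilities and clustering of cut levels\<close>

context bd_chain
begin

lemma first_hit_depends: "depends_upto m (\<lambda>s. first_hit s y m)"
  unfolding depends_upto_def using first_hit_cong[of m] by blast

lemma first_hit_measurable[measurable]: "Measurable.pred M (\<lambda>\<omega>. first_hit (path \<omega>) y m)"
  by (rule depends_upto_measurable[OF first_hit_depends])

lemma cut_level_measurable[measurable]: "Measurable.pred M (\<lambda>\<omega>. cut_level (path \<omega>) x)"
  unfolding cut_level_def by measurable

lemma first_cut_measurable[measurable]: "Measurable.pred M (\<lambda>\<omega>. first_cut a (path \<omega>) j)"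
  unfolding first_cut_def by measurable

text \<open>The strong Markov property at the random time selected by \<open>A\<close>:
  \<open>disj\<close> makes the events for different \<open>m\<close> disjoint, and
  \<open>prob_stay_above\<close> is summed over \<open>m\<close>.\<close>

lemma prob_stay_above_stopped:
  assumes x: "x \<ge> 1" and A: "\<And>m. depends_upto m (A m)" and y: "y > x"
    and Ay: "\<And>m s. A m s \<Longrightarrow> s m = y" and disj: "\<And>m n s. A m s \<Longrightarrow> A n s \<Longrightarrow> m = n"
  shows "\<P>(\<omega> in M. \<exists>m. A m (path \<omega>) \<and> (\<forall>i\<ge>m. S i \<omega> > x))
       = \<P>(\<omega> in M. \<exists>m. A m (path \<omega>)) * escape x y"
proof -
  have [measurable]: "Measurable.pred M (\<lambda>\<omega>. A m (path \<omega>))" for m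
    by (rule depends_upto_measurable[OF A])
  let ?B = "\<lambda>m. {\<omega>\<in>space M. A m (path \<omega>) \<and> (\<forall>i\<ge>m. S i \<omega> > x)}"
  let ?C = "\<lambda>m. {\<omega>\<in>space M. A m (path \<omega>)}"
  have "(\<lambda>m. measure M (?B m)) sums measure M (\<Union>m. ?B m)"
  proof (rule finite_measure_UNION)
    have "?B m \<in> sets M" for m by measurable
    then show "range ?B \<subseteq> sets M" by blast
    show "disjoint_family ?B" using disj unfolding disjoint_family_on_def by blast
  qed
  moreover have "(\<lambda>m. measure M (?C m)) sums measure M (\<Union>m. ?C m)"
  proof (rule finite_measure_UNION)
    have "?C m \<in> sets M" for m by measurable
    then show "range ?C \<subseteq> sets M" by blast
    show "disjoint_family ?C" using disj unfolding disjoint_family_on_def by blast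
  qed
  then have "(\<lambda>m. measure M (?C m) * escape x y) sums (measure M (\<Union>m. ?C m) * escape x y)"
    by (rule sums_mult2)
  moreover have "measure M (?B m) = measure M (?C m) * escape x y" for m
    by (rule prob_stay_above[OF x A[of m] _ y]) (rule Ay)
  ultimately have "measure M (\<Union>m. ?B m) = measure M (\<Union>m. ?C m) * escape x y"
    by (simp add: sums_unique2)
  moreover have "(\<Union>m. ?B m) = {\<omega>\<in>space M. \<exists>m. A m (path \<omega>) \<and> (\<forall>i\<ge>m. S i \<omega> > x)}"
    "(\<Union>m. ?C m) = {\<omega>\<in>space M. \<exists>m. A m (path \<omega>)}" by auto
  ultimately show ?thesis by simp
qed

text \<open>Bounding the probability of ever making a first hit of \<open>x + 1\<close> by
  \<open>1\<close> gives an estimate uniform in the initial law.\<close>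

lemma prob_cut_level_le:
  assumes "x \<ge> 1"
  shows "\<P>(\<omega> in M. cut_level (path \<omega>) x) \<le> r x / tail x"
proof -
  have "\<P>(\<omega> in M. cut_level (path \<omega>) x)
      = \<P>(\<omega> in M. \<exists>m. first_hit (path \<omega>) (Suc x) m) * escape x (Suc x)"
    unfolding cut_level_def
  proof (rule prob_stay_above_stopped[OF assms, of "\<lambda>m s. first_hit s (Suc x) m"])
    show "first_hit s (Suc x) m \<Longrightarrow> first_hit s (Suc x) n \<Longrightarrow> m = n" for s m n
      by (rule first_hit_unique)
  qed (simp_all add: first_hit_depends, simp add: first_hit_def)
  also have "\<dots> \<le> 1 * escape x (Suc x)"
    using escape_bounds[OF assms, of "Suc x"] by (intro mult_right_mono) auto
  finally show ?thesis by (simp add: escape_Suc[OF assms])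
qed

text \<open>
  At the first hit of \<open>x + 1\<close>, let \<open>A\<close> be the event that \<open>j\<close> still looks like the first cutpoint.
  Both probabilities are that of \<open>A\<close> times the chance to stay above \<open>x\<close>, respectively \<open>j\<close>, from
  \<open>x + 1\<close>; so the strong Markov property is needed at one time only.
\<close>
lemma prob_two_cut_levels:
  assumes j: "j \<ge> 1" and jx: "j \<le> x"
  shows "\<P>(\<omega> in M. first_cut a (path \<omega>) j \<and> cut_level (path \<omega>) x) * escape j (Suc x)
       = \<P>(\<omega> in M. first_cut a (path \<omega>) j) * escape x (Suc x)"
proof -
  define A where "A m s \<longleftrightarrow> first_hit s (Suc x) m \<and> cut_level_until m s j \<and>
      (\<forall>i\<in>{a..<j}. \<not> cut_level_until m s i)" for m s
  have A: "depends_upto m (A m)" for m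
    unfolding depends_upto_def A_def
    using first_hit_cong[of m] cut_level_until_cong[of m] by (metis order_refl)
  have Ay: "A m s \<Longrightarrow> s m = Suc x" for m s by (simp add: A_def first_hit_def)
  have disj: "A m s \<Longrightarrow> A n s \<Longrightarrow> m = n" for m n s
    unfolding A_def using first_hit_unique by blast
  have [measurable]: "Measurable.pred M (\<lambda>\<omega>. A m (path \<omega>))" for m
    by (rule depends_upto_measurable[OF A])
  have x: "x \<ge> 1" using j jx by simp
  have stay: "\<P>(\<omega> in M. \<exists>m. A m (path \<omega>) \<and> (\<forall>i\<ge>m. S i \<omega> > z))
      = \<P>(\<omega> in M. \<exists>m. A m (path \<omega>)) * escape z (Suc x)" if "1 \<le> z" "z \<le> x" for z
  proof (rule prob_stay_above_stopped[OF that(1)])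
    show "depends_upto m (A m)" for m by (rule A)
    show "A m s \<Longrightarrow> s m = Suc x" for m s by (rule Ay)
    show "A m s \<Longrightarrow> A n s \<Longrightarrow> m = n" for m n s by (rule disj)
  qed (use that in simp)
  have G: "first_cut a s j \<longleftrightarrow> A m s \<and> (\<forall>l\<ge>m. s l > j)" if "first_hit s (Suc x) m" for s m
    using first_cut_iff[OF that jx, of a] that unfolding A_def by blast
  have "\<P>(\<omega> in M. first_cut a (path \<omega>) j)
      = \<P>(\<omega> in M. \<exists>m. A m (path \<omega>) \<and> (\<forall>i\<ge>m. S i \<omega> > j))"
  proof (rule prob_eq_AE)
    \<comment> \<open>The equivalence is only almost sure: a first hit of \<open>x + 1\<close> must
      exist, which needs unit steps and divergence of the path.\<close>
    show "AE \<omega> in M. first_cut a (path \<omega>) j \<longleftrightarrow> (\<exists>m. A m (path \<omega>) \<and> (\<forall>i\<ge>m. S i \<omega> > j))"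
      using AE_nearest AE_to_infinity
    proof eventually_elim
      case (elim \<omega>)
      show ?case
      proof
        assume f: "first_cut a (path \<omega>) j"
        then obtain n where "first_hit (path \<omega>) (Suc j) n"
          by (auto simp: first_cut_def cut_level_def)
        then have "S 0 \<omega> \<le> Suc x"
          using jx unfolding first_hit_def by (metis Suc_le_mono gr0I le_trans less_imp_le order_refl)
        then obtain m where "first_hit (path \<omega>) (Suc x) m"
          using first_hit_exists[of "path \<omega>" "Suc x"] elim by blast
        with G f show "\<exists>m. A m (path \<omega>) \<and> (\<forall>i\<ge>m. S i \<omega> > j)" by blast
      next
        assume "\<exists>m. A m (path \<omega>) \<and> (\<forall>i\<ge>m. S i \<omega> > j)"
        then show "first_cut a (path \<omega>) j" using G unfolding A_def by blast
      qed
    qed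
  qed measurable
  also have "\<dots> = \<P>(\<omega> in M. \<exists>m. A m (path \<omega>)) * escape j (Suc x)"
    by (rule stay[OF j jx])
  finally have 1: "\<P>(\<omega> in M. first_cut a (path \<omega>) j)
      = \<P>(\<omega> in M. \<exists>m. A m (path \<omega>)) * escape j (Suc x)" .
  \<comment> \<open>Now \<open>cut_level s x\<close> itself supplies the first hit, so the
    equivalence holds for every path.\<close>
  have "first_cut a s j \<and> cut_level s x \<longleftrightarrow> (\<exists>m. A m s \<and> (\<forall>i\<ge>m. s i > x))" for s
  proof
    assume *: "first_cut a s j \<and> cut_level s x"
    then obtain m where "first_hit s (Suc x) m" "\<forall>i\<ge>m. s i > x" by (auto simp: cut_level_def)
    with * G show "\<exists>m. A m s \<and> (\<forall>i\<ge>m. s i > x)" by blast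
  next
    assume "\<exists>m. A m s \<and> (\<forall>i\<ge>m. s i > x)"
    then obtain m where m: "A m s" "\<forall>i\<ge>m. s i > x" by blast
    then have h: "first_hit s (Suc x) m" by (simp add: A_def)
    with m have "cut_level s x" by (auto simp: cut_level_def)
    moreover have "\<forall>i\<ge>m. s i > j" using m jx by (meson le_less_trans)
    ultimately show "first_cut a s j \<and> cut_level s x" using G[OF h] m by blast
  qed
  then have 2: "\<P>(\<omega> in M. first_cut a (path \<omega>) j \<and> cut_level (path \<omega>) x)
      = \<P>(\<omega> in M. \<exists>m. A m (path \<omega>)) * escape x (Suc x)"
    using stay[OF x order_refl] by simp
  show ?thesis unfolding 1 2 by simp
qed

text \<open>The quotient of the two escape probabilities is the stated ratio times
  \<open>tail j / tail x\<close>, which is at least \<open>1\<close>.\<close>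

lemma prob_two_cut_levels_ge:
  assumes j: "j \<ge> 1" and jx: "j \<le> x"
  shows "\<P>(\<omega> in M. first_cut a (path \<omega>) j) * (r x / sum r {j..x})
       \<le> \<P>(\<omega> in M. first_cut a (path \<omega>) j \<and> cut_level (path \<omega>) x)"
    (is "?p * _ \<le> ?q")
proof -
  have x: "x \<ge> 1" using j jx by simp
  have s: "sum r {j..x} > 0"
    using j jx r_pos by (intro sum_pos) auto
  have e: "escape j (Suc x) = sum r {j..x} / tail j"
    using escape_sum[OF j, of "Suc x"] jx by (simp add: atLeastLessThanSuc_atLeastAtMost)
  have "?q * (sum r {j..x} / tail j) = ?p * (r x / tail x)"
    using prob_two_cut_levels[OF j jx, of a] unfolding e escape_Suc[OF x] .
  then have "?q = ?p * (r x / tail x) * tail j / sum r {j..x}"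
    using s tail_pos[OF j] tail_pos[OF x] by (simp add: divide_simps) (simp add: algebra_simps)
  also have "\<dots> = ?p * (r x / sum r {j..x}) * (tail j / tail x)"
    by simp
  also have "\<dots> \<ge> ?p * (r x / sum r {j..x}) * 1"
    using tail_antimono[OF j jx] tail_pos[OF x] s r_pos[OF x]
    by (intro mult_left_mono mult_nonneg_nonneg) auto
  finally show ?thesis by simp
qed

text \<open>The expected number of cut levels in \<open>{a..<c}\<close> is at least the chance of
  one in \<open>{a..<b}\<close> times the least conditional cluster size \<open>L\<close>. The
  window reaches to \<open>c\<close> so that a first cut level near \<open>b\<close> still has room
  for its cluster.\<close>

lemma prob_cut_level_in_block_le:
  assumes a: "a \<ge> 1" and bc: "b \<le> c"
    and L: "\<And>j. j \<in> {a..<b} \<Longrightarrow> L \<le> (\<Sum>x\<in>{j..<c}. r x / sum r {j..x})" and L0: "L \<ge> 0"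
  shows "L * \<P>(\<omega> in M. \<exists>j\<in>{a..<b}. cut_level (path \<omega>) j) \<le> (\<Sum>x\<in>{a..<c}. r x / tail x)"
proof -
  let ?G = "\<lambda>j. {\<omega>\<in>space M. first_cut a (path \<omega>) j}"
  let ?V = "\<lambda>x. {\<omega>\<in>space M. cut_level (path \<omega>) x}"
  let ?GV = "\<lambda>j x. {\<omega>\<in>space M. first_cut a (path \<omega>) j \<and> cut_level (path \<omega>) x}"
  have Gm: "?G j \<in> sets M" and Vm: "?V j \<in> sets M" and GVm: "?GV j x \<in> sets M" for j x
    by measurable
  have disj: "i = j" if "first_cut a s i" "first_cut a s j" "i \<ge> a" "j \<ge> a" for s i j
    using that unfolding first_cut_def by (metis atLeastLessThan_iff linorder_neqE_nat)
  have "\<P>(\<omega> in M. \<exists>j\<in>{a..<b}. cut_level (path \<omega>) j) \<le> measure M (\<Union>j\<in>{a..<b}. ?G j)"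
  proof (rule finite_measure_mono)
    show "{\<omega>\<in>space M. \<exists>j\<in>{a..<b}. cut_level (path \<omega>) j} \<subseteq> (\<Union>j\<in>{a..<b}. ?G j)"
    proof safe
      fix \<omega> j assume \<omega>: "\<omega> \<in> space M" and j: "j \<in> {a..<b}" "cut_level (path \<omega>) j"
      define i where "i = (LEAST i. a \<le> i \<and> cut_level (path \<omega>) i)"
      have "a \<le> i \<and> cut_level (path \<omega>) i"
        unfolding i_def by (rule LeastI[of _ j]) (use j in auto)
      moreover have "i \<le> j" unfolding i_def by (rule Least_le) (use j in auto)
      moreover have "\<not> cut_level (path \<omega>) l" if "l \<in> {a..<i}" for l
        using not_less_Least[of l "\<lambda>i. a \<le> i \<and> cut_level (path \<omega>) i"] that
        by (auto simp: i_def)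
      ultimately show "\<omega> \<in> (\<Union>j\<in>{a..<b}. ?G j)"
        using \<omega> j by (auto simp: first_cut_def intro!: bexI[of _ i])
    qed
  qed (use Gm in auto)
  also have "\<dots> \<le> (\<Sum>j\<in>{a..<b}. measure M (?G j))"
    by (rule finite_measure_subadditive_finite) (use Gm in auto)
  finally have "L * \<P>(\<omega> in M. \<exists>j\<in>{a..<b}. cut_level (path \<omega>) j)
      \<le> (\<Sum>j\<in>{a..<b}. measure M (?G j) * L)"
    unfolding sum_distrib_right[symmetric] using L0 by (subst mult.commute) (rule mult_right_mono)
  also have "\<dots> \<le> (\<Sum>j\<in>{a..<b}. measure M (?G j) * (\<Sum>x\<in>{j..<c}. r x / sum r {j..x}))"
    by (intro sum_mono mult_left_mono L) auto
  also have "\<dots> \<le> (\<Sum>j\<in>{a..<b}. \<Sum>x\<in>{j..<c}. measure M (?GV j x))"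
    unfolding sum_distrib_left
    by (intro sum_mono prob_two_cut_levels_ge) (use a in auto)
  also have "\<dots> \<le> (\<Sum>j\<in>{a..<b}. \<Sum>x\<in>{a..<c}. measure M (?GV j x))"
    by (intro sum_mono sum_mono2) auto
  also have "\<dots> = (\<Sum>x\<in>{a..<c}. \<Sum>j\<in>{a..<b}. measure M (?GV j x))"
    by (rule sum.swap)
  also have "\<dots> \<le> (\<Sum>x\<in>{a..<c}. r x / tail x)"
  proof (rule sum_mono)
    fix x assume x: "x \<in> {a..<c}"
    \<comment> \<open>At most one \<open>j\<close> is the first cut level, so for fixed
      \<open>x\<close> the contributions add up to at most the probability that \<open>x\<close> is
      a cut level.\<close>
    have "(\<Sum>j\<in>{a..<b}. measure M (?GV j x)) = measure M (\<Union>j\<in>{a..<b}. ?GV j x)"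
      by (rule finite_measure_finite_Union[symmetric])
        (use GVm disj in \<open>auto simp: disjoint_family_on_def\<close>)
    also have "\<dots> \<le> measure M (?V x)"
      by (rule finite_measure_mono) (use Vm in auto)
    also have "\<dots> \<le> r x / tail x"
      using prob_cut_level_le[of x] x a by simp
    finally show "(\<Sum>j\<in>{a..<b}. measure M (?GV j x)) \<le> r x / tail x" .
  qed
  finally show ?thesis .
qed

end

subsection \<open>The rates\<close>

text \<open>Cauchy condensation reduces this to a \<open>p\<close>-series. The shift inside
  \<open>ln\<close> keeps the terms decreasing from \<open>n = 1\<close> on, where
  \<open>ln 1\<close> would give the value \<open>0\<close>.\<close>

lemma summable_bertrand:
  fixes \<beta> :: real
  assumes "\<beta> > 1"
  shows "summable (\<lambda>n. 1 / real n * ln (real n + 1) powr (- \<beta>))"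
proof -
  let ?f = "\<lambda>n. 1 / real n * ln (real n + 1) powr (- \<beta>)"
  have "summable (\<lambda>n. 2 ^ n * ?f (2 ^ n))"
  proof (rule summable_comparison_test')
    show "summable (\<lambda>n. ln 2 powr (- \<beta>) * real n powr (- \<beta>))"
      using assms by (intro summable_mult) (simp add: summable_real_powr_iff)
    fix n :: nat assume n: "1 \<le> n"
    have "real n * ln 2 = ln (2 ^ n)" by (simp add: ln_realpow)
    also have "\<dots> \<le> ln (2 ^ n + 1)" by (subst ln_le_cancel_iff) (auto intro: add_pos_pos)
    finally have "ln (2 ^ n + 1) powr (- \<beta>) \<le> (real n * ln 2) powr (- \<beta>)"
      using n assms by (intro powr_mono2') auto
    then show "norm (2 ^ n * ?f (2 ^ n)) \<le> ln 2 powr (- \<beta>) * real n powr (- \<beta>)"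
      by (simp add: powr_mult mult.commute)
  qed
  also have "summable (\<lambda>n. 2 ^ n * ?f (2 ^ n)) \<longleftrightarrow> summable ?f"
  proof (rule condensation_test[symmetric])
    fix m :: nat assume m: "0 < m"
    show "?f (Suc m) \<le> ?f m"
      using m assms by (intro mult_mono powr_mono2' frac_le) auto
  qed auto
  finally show ?thesis .
qed

lemma sum_dyadic_blocks:
  fixes f :: "nat \<Rightarrow> real"
  assumes "m \<le> n"
  shows "sum f {2 ^ m..<2 ^ n} = (\<Sum>l=m..<n. sum f {2 ^ l..<2 ^ Suc l})"
  using assms
proof (induction n rule: dec_induct)
  case (step n)
  have "sum f {2 ^ m..<2 ^ Suc n} = sum f {2 ^ m..<2 ^ n} + sum f {2 ^ n..<2 ^ Suc n}"
    using step.hyps by (intro sum.atLeastLessThan_concat[symmetric]) (auto intro: power_increasing)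
  then show ?case using step by simp
qed simp

locale log_rates =
  fixes r :: "nat \<Rightarrow> real" and \<beta> c C :: real
  assumes beta: "\<beta> > 1" and c: "0 < c" "c \<le> C"
    and r_bounds: "\<And>k. k \<ge> 2 \<Longrightarrow> c * (1 / real k) * ln (real k) powr (- \<beta>) \<le> r k"
      "\<And>k. k \<ge> 2 \<Longrightarrow> r k \<le> C * (1 / real k) * ln (real k) powr (- \<beta>)"
begin

text \<open>The factor \<open>ln 2\<close> arises from \<open>ln (2 ^ k) = k * ln 2\<close> at
  dyadic points.\<close>

definition upper_const :: real where "upper_const = C * ln 2 powr (- \<beta>)"

lemma upper_const_pos: "upper_const > 0"
  using c by (simp add: upper_const_def)

lemma r_lower:
  assumes i: "2 \<le> i" and l: "i \<le> 2 ^ l"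
  shows "c * (1 / 2 ^ l) * real l powr (- \<beta>) \<le> r i"
proof -
  have "real i \<le> 2 ^ l" using l by (metis of_nat_le_iff of_nat_numeral of_nat_power)
  have "l \<noteq> 0" using i l by (metis le_trans numeral_le_one_iff power_0 semiring_norm(69))
  have "ln (real i) \<le> ln (2 ^ l)" using i \<open>real i \<le> 2 ^ l\<close> by (subst ln_le_cancel_iff) auto
  also have "\<dots> = real l * ln 2" by (simp add: ln_realpow)
  also have "\<dots> \<le> real l" using ln_2_less_1 by (simp add: mult_left_le)
  finally have "real l powr (- \<beta>) \<le> ln (real i) powr (- \<beta>)"
    using i beta by (intro powr_mono2') auto
  then have "c * (1 / 2 ^ l) * real l powr (- \<beta>) \<le> c * (1 / real i) * ln (real i) powr (- \<beta>)"
    using i c \<open>real i \<le> 2 ^ l\<close> by (intro mult_mono frac_le) auto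
  also have "\<dots> \<le> r i" by (rule r_bounds(1)[OF i])
  finally show ?thesis .
qed

lemma r_upper:
  assumes k: "k \<ge> 1" and i: "2 ^ k \<le> i"
  shows "r i \<le> upper_const * (1 / 2 ^ k) * real k powr (- \<beta>)"
proof -
  have "(2::nat) ^ 1 \<le> 2 ^ k" using k by (intro power_increasing) auto
  then have i2: "i \<ge> 2" using i by simp
  have ik: "2 ^ k \<le> real i" using i by (metis of_nat_le_iff of_nat_numeral of_nat_power)
  have "real k * ln 2 = ln (2 ^ k)" by (simp add: ln_realpow)
  also have "\<dots> \<le> ln (real i)" using ik i2 by (subst ln_le_cancel_iff) auto
  finally have "ln (real i) powr (- \<beta>) \<le> (real k * ln 2) powr (- \<beta>)"
    using k beta by (intro powr_mono2') auto
  also have "\<dots> = ln 2 powr (- \<beta>) * real k powr (- \<beta>)" by (simp add: powr_mult mult.commute)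
  finally have *: "ln (real i) powr (- \<beta>) \<le> ln 2 powr (- \<beta>) * real k powr (- \<beta>)" .
  have "r i \<le> C * (1 / real i) * ln (real i) powr (- \<beta>)" by (rule r_bounds(2)[OF i2])
  also have "\<dots> \<le> C * (1 / 2 ^ k) * (ln 2 powr (- \<beta>) * real k powr (- \<beta>))"
    using * ik c i2 by (intro mult_mono frac_le) auto
  finally show ?thesis by (simp add: upper_const_def mult_ac)
qed

text \<open>For \<open>n \<ge> 2\<close>, \<open>n + 1 \<le> n * n\<close> gives
  \<open>ln (n + 1) \<le> 2 * ln n\<close>, so the shifted series dominates at the cost of a factor
  \<open>2 powr \<beta>\<close>.\<close>

lemma summable_rates:
  assumes "\<And>k. k \<ge> 1 \<Longrightarrow> r k > 0"
  shows "summable r"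
proof (rule summable_comparison_test')
  show "summable (\<lambda>n. C * 2 powr \<beta> * (1 / real n * ln (real n + 1) powr (- \<beta>)))"
    by (intro summable_mult summable_bertrand beta)
  fix n :: nat assume n: "2 \<le> n"
  have "2 * real n \<le> real n * real n" using n by (intro mult_right_mono) auto
  with n have "real n + 1 \<le> real n * real n" by linarith
  then have "ln (real n + 1) \<le> ln (real n * real n)"
    using n by (subst ln_le_cancel_iff) auto
  also have "\<dots> = 2 * ln (real n)" using n by (simp add: ln_mult)
  finally have "(2 * ln (real n)) powr (- \<beta>) \<le> ln (real n + 1) powr (- \<beta>)"
    using n beta by (intro powr_mono2') auto
  then have "2 powr (- \<beta>) * ln (real n) powr (- \<beta>) \<le> ln (real n + 1) powr (- \<beta>)"
    by (simp add: powr_mult)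
  then have "2 powr \<beta> * (2 powr (- \<beta>) * ln (real n) powr (- \<beta>)) \<le> 2 powr \<beta> * ln (real n + 1) powr (- \<beta>)"
    by (intro mult_left_mono) auto
  then have *: "ln (real n) powr (- \<beta>) \<le> 2 powr \<beta> * ln (real n + 1) powr (- \<beta>)"
    by (simp add: mult.assoc[symmetric] powr_add[symmetric])
  have "norm (r n) \<le> C * (1 / real n) * ln (real n) powr (- \<beta>)"
    using r_bounds(2)[OF n] assms[of n] n by simp
  also have "\<dots> \<le> C * (1 / real n) * (2 powr \<beta> * ln (real n + 1) powr (- \<beta>))"
    using * c by (intro mult_left_mono) auto
  finally show "norm (r n) \<le> C * 2 powr \<beta> * (1 / real n * ln (real n + 1) powr (- \<beta>))"
    by (simp add: mult_ac)
qed

text \<open>There are \<open>k + 2\<close> dyadic blocks. Block \<open>l\<close> has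
  \<open>2 ^ l\<close> terms of size at least \<open>c / 2 ^ (l + 1)\<close> times
  \<open>(l + 1) powr (- \<beta>)\<close>, and \<open>l + 1 \<le> 6 * k\<close>. This bounds
  \<open>tail\<close> from below on the window used later.\<close>

lemma dyadic_sum_lower:
  assumes k: "k \<ge> 1"
  shows "c / 2 * 6 powr (- \<beta>) * (real k * real k powr (- \<beta>)) \<le> sum r {2 ^ (k + 2)..<2 ^ (2 * k + 4)}"
proof -
  have block: "c / 2 * (6 powr (- \<beta>) * real k powr (- \<beta>)) \<le> sum r {2 ^ l..<2 ^ Suc l}"
    if l: "k + 2 \<le> l" "l < 2 * k + 4" for l
  proof -
    have "(6 * real k) powr (- \<beta>) \<le> real (Suc l) powr (- \<beta>)"
      using l k beta by (intro powr_mono2') auto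
    then have *: "6 powr (- \<beta>) * real k powr (- \<beta>) \<le> real (Suc l) powr (- \<beta>)"
      by (simp add: powr_mult)
    have "c / 2 * (6 powr (- \<beta>) * real k powr (- \<beta>)) \<le> c / 2 * real (Suc l) powr (- \<beta>)"
      using * c by (intro mult_left_mono) auto
    also have "\<dots> = real (card {2 ^ l..<2 ^ Suc l :: nat}) * (c * (1 / 2 ^ Suc l) * real (Suc l) powr (- \<beta>))"
      by simp
    also have "\<dots> \<le> sum r {2 ^ l..<2 ^ Suc l}"
    proof (rule sum_bounded_below)
      fix i assume i: "i \<in> {2 ^ l..<2 ^ Suc l :: nat}"
      have "(2::nat) ^ 1 \<le> 2 ^ l" using l by (intro power_increasing) auto
      with i show "c * (1 / 2 ^ Suc l) * real (Suc l) powr (- \<beta>) \<le> r i"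
        by (intro r_lower) auto
    qed
    finally show ?thesis .
  qed
  have "c / 2 * 6 powr (- \<beta>) * (real k * real k powr (- \<beta>))
      = real k * (c / 2 * (6 powr (- \<beta>) * real k powr (- \<beta>)))"
    by (simp add: mult_ac)
  also have "\<dots> \<le> real (card {k + 2..<2 * k + 4}) * (c / 2 * (6 powr (- \<beta>) * real k powr (- \<beta>)))"
    using c by (intro mult_right_mono) auto
  also have "\<dots> \<le> (\<Sum>l=k + 2..<2 * k + 4. sum r {2 ^ l..<2 ^ Suc l})"
    by (rule sum_bounded_below) (use block in auto)
  also have "\<dots> = sum r {2 ^ (k + 2)..<2 ^ (2 * k + 4)}"
    by (rule sum_dyadic_blocks[symmetric]) simp
  finally show ?thesis .
qed

lemma harmonic_lower:
  assumes pos: "\<And>k. k \<ge> 1 \<Longrightarrow> r k > 0" and k: "k \<ge> 1" and j: "j \<in> {2 ^ k..<2 ^ Suc k}"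
  shows "c / 4 * 3 powr (- \<beta>) / upper_const * (real k * ln 2) \<le> (\<Sum>x\<in>{j..<2 ^ (k + 2)}. r x / sum r {j..x})"
proof -
  \<comment> \<open>The lower bound on \<open>r\<close> at scale \<open>2 ^ (k + 2)\<close> over the
    upper bound at scale \<open>2 ^ k\<close>: the \<open>4\<close> compares the scales, the
    \<open>3\<close> comes from \<open>k + 2 \<le> 3 * k\<close>.\<close>
  define q where "q = c / 4 * 3 powr (- \<beta>) / upper_const"
  have q: "q > 0" using c upper_const_pos by (simp add: q_def)
  have "(2::nat) ^ 1 \<le> 2 ^ k" using k by (intro power_increasing) auto
  then have j2: "j \<ge> 2" using j by auto
  have sp: "sum r {j..x} > 0" if "x \<ge> j" for x
    using that j2 pos by (intro sum_pos) auto
  have ratio: "q * (1 / real (x + 1 - j)) \<le> r x / sum r {j..x}" if x: "j \<le> x" "x < 2 ^ (k + 2)" for x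
  proof -
    have "(3 * real k) powr (- \<beta>) \<le> real (k + 2) powr (- \<beta>)"
      using k beta by (intro powr_mono2') auto
    then have "3 powr (- \<beta>) * real k powr (- \<beta>) \<le> real (k + 2) powr (- \<beta>)"
      by (simp add: powr_mult)
    then have "c * (1 / 2 ^ (k + 2)) * (3 powr (- \<beta>) * real k powr (- \<beta>))
        \<le> c * (1 / 2 ^ (k + 2)) * real (k + 2) powr (- \<beta>)"
      using c by (intro mult_left_mono) auto
    also have "\<dots> \<le> r x" by (rule r_lower) (use x j2 in auto)
    finally have rx: "q * (upper_const * (1 / 2 ^ k) * real k powr (- \<beta>)) \<le> r x"
      using upper_const_pos by (simp add: q_def field_simps)
    have "sum r {j..x} \<le> real (card {j..x}) * (upper_const * (1 / 2 ^ k) * real k powr (- \<beta>))"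
      by (rule sum_bounded_above) (use r_upper[OF k] j in auto)
    then have "q * (1 / real (x + 1 - j)) * sum r {j..x}
        \<le> q * (1 / real (x + 1 - j)) * (real (card {j..x}) * (upper_const * (1 / 2 ^ k) * real k powr (- \<beta>)))"
      using q by (intro mult_left_mono) auto
    also have "\<dots> = q * (upper_const * (1 / 2 ^ k) * real k powr (- \<beta>))" using x by simp
    also note rx
    finally show ?thesis using sp[OF x(1)] by (simp add: pos_le_divide_eq)
  qed
  have "real k * ln 2 = ln (2 ^ k)" by (simp add: ln_realpow)
  also have "\<dots> \<le> ln (real (2 ^ k) + 1)"
    by (subst ln_le_cancel_iff) (auto intro: add_pos_pos)
  also have "\<dots> \<le> harm (2 ^ k)" by (rule ln_le_harm)
  \<comment> \<open>The ratios dominate a harmonic sum of length \<open>2 ^ k\<close>; it fits into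
    the window because \<open>j + 2 ^ k < 2 ^ (k + 2)\<close>.\<close>
  also have "harm (2 ^ k) = (\<Sum>x\<in>{j..<j + 2 ^ k}. 1 / real (x + 1 - j))"
    unfolding harm_def
    by (rule sum.reindex_bij_witness[of _ "\<lambda>x. x + 1 - j" "\<lambda>n. n + j - 1"])
      (auto simp: inverse_eq_divide)
  finally have "q * (real k * ln 2) \<le> (\<Sum>x\<in>{j..<j + 2 ^ k}. q * (1 / real (x + 1 - j)))"
    unfolding sum_distrib_left[symmetric] using q by (intro mult_left_mono) auto
  also have "\<dots> \<le> (\<Sum>x\<in>{j..<j + 2 ^ k}. r x / sum r {j..x})"
    by (intro sum_mono ratio) (use j in auto)
  also have "\<dots> \<le> (\<Sum>x\<in>{j..<2 ^ (k + 2)}. r x / sum r {j..x})"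
    using j j2 sp pos by (intro sum_mono2) (auto intro!: divide_nonneg_nonneg less_imp_le)
  finally show ?thesis by (simp add: q_def)
qed

end

section \<open>Borel-Cantelli along dyadic blocks\<close>

locale bd_chain_log = bd_chain M r S + log_rates r \<beta> c C
  for M :: "'a measure" and r and S :: "nat \<Rightarrow> 'a \<Rightarrow> nat" and \<beta> c C
begin

text \<open>Each of the \<open>3 * 2 ^ k\<close> terms has numerator of order
  \<open>k powr (- \<beta>) / 2 ^ k\<close> at most and denominator of order
  \<open>k * k powr (- \<beta>)\<close> at least; the powers cancel and leave
  \<open>1 / k\<close>.\<close>

lemma sum_escape_le:
  assumes k: "k \<ge> 1"
  shows "(\<Sum>x\<in>{2 ^ k..<2 ^ (k + 2)}. r x / tail x) \<le> 3 * upper_const / (c / 2 * 6 powr (- \<beta>)) / real k"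
proof -
  define d where "d = c / 2 * 6 powr (- \<beta>)"
  have d: "d > 0" using c by (simp add: d_def)
  have "(\<Sum>x\<in>{2 ^ k..<2 ^ (k + 2)}. r x / tail x)
      \<le> real (card {2 ^ k..<2 ^ (k + 2) :: nat}) * (upper_const / d * (1 / 2 ^ k) / real k)"
  proof (rule sum_bounded_above)
    fix x :: nat assume x: "x \<in> {2 ^ k..<2 ^ (k + 2)}"
    then have x1: "x \<ge> 1" using one_le_power[of "2::nat" k] by (auto simp del: one_le_power)
    have "d * (real k * real k powr (- \<beta>)) \<le> sum r {2 ^ (k + 2)..<2 ^ (2 * k + 4)}"
      unfolding d_def by (rule dyadic_sum_lower[OF k])
    also have "\<dots> \<le> sum r {x..<2 ^ (2 * k + 4)}"
      using x x1 r_pos by (intro sum_mono2) (auto intro!: less_imp_le)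
    also have "\<dots> \<le> tail x" by (rule tail_ge_sum[OF x1])
    finally have "r x / tail x \<le> (upper_const * (1 / 2 ^ k) * real k powr (- \<beta>)) / (d * (real k * real k powr (- \<beta>)))"
      using r_upper[OF k, of x] x d k upper_const_pos by (intro frac_le) auto
    also have "\<dots> = upper_const / d * (1 / 2 ^ k) / real k"
      using k by (simp add: field_simps)
    finally show "r x / tail x \<le> upper_const / d * (1 / 2 ^ k) / real k" .
  qed
  also have "card {2 ^ k..<2 ^ (k + 2) :: nat} = 3 * 2 ^ k" by simp
  also have "real (3 * 2 ^ k) * (upper_const / d * (1 / 2 ^ k) / real k) = 3 * upper_const / d / real k"
    by simp
  finally show ?thesis by (simp add: d_def)
qed

text \<open>Expected count of order at most \<open>1 / k\<close>, divided by cluster size of order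
  at least \<open>k\<close>, gives \<open>1 / k ^ 2\<close>.\<close>

lemma summable_prob_cut_level_in_block:
  "summable (\<lambda>k. \<P>(\<omega> in M. \<exists>j\<in>{2 ^ k..<2 ^ Suc k}. cut_level (path \<omega>) j))"
proof (rule summable_comparison_test')
  define q where "q = c / 4 * 3 powr (- \<beta>) / upper_const"
  define K where "K = 3 * upper_const / (c / 2 * 6 powr (- \<beta>))"
  have q: "q > 0" using c upper_const_pos by (simp add: q_def)
  show "summable (\<lambda>k. K / (q * ln 2) * inverse (real k ^ 2))"
    by (intro summable_mult inverse_power_summable) simp
  fix k :: nat assume k: "1 \<le> k"
  let ?p = "\<P>(\<omega> in M. \<exists>j\<in>{2 ^ k..<2 ^ Suc k}. cut_level (path \<omega>) j)"
  have nonneg: "q * (real k * ln 2) \<ge> 0" using q by simp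
  have "q * (real k * ln 2) * ?p \<le> (\<Sum>x\<in>{2 ^ k..<2 ^ (k + 2)}. r x / tail x)"
    by (rule prob_cut_level_in_block_le[OF _ _ _ nonneg])
      (use harmonic_lower[OF r_pos k] in \<open>auto simp: q_def\<close>)
  also have "\<dots> \<le> K / real k" unfolding K_def by (rule sum_escape_le[OF k])
  finally have "?p \<le> K / real k / (q * (real k * ln 2))"
    using q k by (simp add: pos_le_divide_eq mult.commute)
  also have "\<dots> = K / (q * ln 2) * inverse (real k ^ 2)"
    by (simp add: field_simps power2_eq_square)
  finally show "norm ?p \<le> K / (q * ln 2) * inverse (real k ^ 2)" by simp
qed

lemma AE_finite_cutpoints: "AE \<omega> in M. finite {x. cutpoint (path \<omega>) x}"
proof -
  let ?B = "\<lambda>k. {\<omega>\<in>space M. \<exists>j\<in>{2 ^ k..<2 ^ Suc k}. cut_level (path \<omega>) j}"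
  have "AE \<omega> in M. eventually (\<lambda>k. \<omega> \<in> space M - ?B k) sequentially"
  proof (rule borel_cantelli_AE1)
    show "?B k \<in> sets M" for k by measurable
  qed (use summable_prob_cut_level_in_block in \<open>simp_all add: emeasure_eq_measure\<close>)
  then show ?thesis
    using AE_nearest AE_to_infinity
  proof eventually_elim
    case (elim \<omega>)
    then obtain N where N: "\<And>k. k \<ge> N \<Longrightarrow> \<omega> \<in> space M - ?B k"
      unfolding eventually_sequentially by blast
    \<comment> \<open>Cutpoints are known to be cut levels only from the starting state upwards;
      below it there are finitely many states anyway.\<close>
    have "x < max (S 0 \<omega>) (2 ^ N)" if "cutpoint (path \<omega>) x" for x
    proof (rule ccontr)
      assume "\<not> x < max (S 0 \<omega>) (2 ^ N)"
      then have x: "S 0 \<omega> \<le> x" "2 ^ N \<le> x" by auto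
      have cl: "cut_level (path \<omega>) x"
        by (rule cutpoint_imp_cut_level[OF _ elim(3) x(1) that]) (use elim(2) in blast)
      have "x \<ge> 1" using x(2) by (metis le_trans one_le_numeral one_le_power)
      then obtain k where k: "2 ^ k \<le> x" "x < 2 ^ (k + 1)"
        using ex_power_ivl1[of 2 x] by auto
      have "k \<ge> N"
      proof (rule ccontr)
        assume "\<not> k \<ge> N"
        then have "(2::nat) ^ (k + 1) \<le> 2 ^ N" by (intro power_increasing) auto
        with k x show False by simp
      qed
      with N[of k] k cl show False by auto
    qed
    then have "{x. cutpoint (path \<omega>) x} \<subseteq> {..<max (S 0 \<omega>) (2 ^ N)}" by blast
    then show ?case using finite_subset by blast
  qed
qed

end

theorem theorem3p1:
  fixes \<beta> :: real and r :: "nat \<Rightarrow> real"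
    and M :: "'a measure" and S :: "nat \<Rightarrow> 'a \<Rightarrow> nat"
  assumes "\<beta> > 1"
    and "\<And>k. k \<ge> 1 \<Longrightarrow> r k > 0"
    and "\<exists>c C. 0 < c \<and> c \<le> C \<and>
           (\<forall>k\<ge>2. c * (1 / real k) * ln (real k) powr (- \<beta>) \<le> r k \<and>
                  r k \<le> C * (1 / real k) * ln (real k) powr (- \<beta>))"
    and "markov_chain {1..} (bd_transition r) M S"
  shows "transient_chain {1..} M S \<and> (AE \<omega> in M. finite {x. cutpoint (\<lambda>n. S n \<omega>) x})"
proof -
  obtain c C where "0 < c" "c \<le> C"
    "\<forall>k\<ge>2. c * (1 / real k) * ln (real k) powr (- \<beta>) \<le> r k \<and>
       r k \<le> C * (1 / real k) * ln (real k) powr (- \<beta>)"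
    using assms(3) by blast
  then interpret log_rates r \<beta> c C
    using assms(1) by unfold_locales auto
  interpret prob_space M
    using assms(4) by (simp add: markov_chain_def)
  interpret bd_chain_log M r S \<beta> c C
    by unfold_locales (use assms summable_rates in auto)
  show ?thesis
    using AE_finite_visits AE_finite_cutpoints by (simp add: transient_chain_def Ball_def)
qed

end
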